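(* Let $n,s$ be integers with $1\le s<n-1$, let $\alpha=(\alpha_1,\dots,\alpha_s)\in\mathbb{R}^s$, and let $k\in\{s+1,\dots,n-1\}$. If there exists $x_0\in\mathbb{R}^n$ such that $$S_{k;s}(x_0)^2<S_{k-1;s}(x_0)\,S_{k+1;s}(x_0),$$ then the polynomial $f(t)=t^s+\alpha_1t^{s-1}+\alpha_2t^{s-2}+\cdots+\alpha_s$ has a non-real complex root.
   Context: For $x=(x_1,\dots,x_n)\in\mathbb{R}^n$, $\sigma_k(x)=\sum_{1\le i_1<\cdots<i_k\le n}x_{i_1}\cdots x_{i_k}$ for $1\le k\le n$ is the $k$-th elementary symmetric function, with $\sigma_0(x)=1$ and $\sigma_k(x)=0$ for $k<0$ or $k>n$. The $k$-th elementary symmetric mean is $E_k(x)=\sigma_k(x)/C_n^k$ for $k=0,1,\dots,n$, where $C_n^k=\frac{n!}{k!(n-k)!}$. For $\alpha\in\mathbb{R}^s$, define $S_{k;s}(x)=E_k(x)+\sum_{i=1}^s\alpha_iE_{k-i}(x)$. *)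

theory Defs
  imports "HOL-Analysis.Analysis" "HOL-Computational_Algebra.Polynomial"
begin

(* The k-subsets of the index type are the index choices i_1 < ... < i_k.  The index k is an
   integer, so that the sum is empty, hence 0, for k < 0 and for k > CARD('n), and is 1 for k = 0. *)
definition esym :: "int \<Rightarrow> real ^ 'n \<Rightarrow> real"
  where "esym k x = (\<Sum>I | I \<subseteq> (UNIV :: 'n set) \<and> int (card I) = k. \<Prod>i\<in>I. x $ i)"

(* The binomial coefficient is meant for 0 <= k <= CARD('n); for any other k
   the numerator is 0, so that the value is 0. *)
definition esym_mean :: "int \<Rightarrow> real ^ 'n \<Rightarrow> real"
  where "esym_mean k x = esym k x / real (CARD('n) choose nat k)"

(* A vector (\<alpha>_1, ..., \<alpha>_s) is a function on nat of which only the values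
   at 1, ..., s are used. *)
definition S_comb :: "nat \<Rightarrow> (nat \<Rightarrow> real) \<Rightarrow> int \<Rightarrow> real ^ 'n \<Rightarrow> real"
  where "S_comb s \<alpha> k x = esym_mean k x + (\<Sum>i=1..s. \<alpha> i * esym_mean (k - int i) x)"

definition assoc_poly :: "nat \<Rightarrow> (nat \<Rightarrow> real) \<Rightarrow> real poly"
  where "assoc_poly s \<alpha> = monom 1 s + (\<Sum>i=1..s. monom (\<alpha> i) (s - i))"

end

theory Submission
  imports Defs "HOL-Computational_Algebra.Fundamental_Theorem_Algebra"
begin

text \<open>
  Suppose that \<open>f\<close> has only real roots. The values \<open>S_comb s \<alpha> k x\<close> then satisfy Newton's inequality,
  because they are the coefficients of a real-rooted polynomial, just as the elementary symmetric
  means are.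

  To a sequence \<open>a\<close> attach the polynomial \<open>P\<close> with coefficients \<open>(n choose j) * a j\<close>. For the means of
  \<open>x\<close> this is the product of the \<open>1 + x\<^sub>i X\<close>, whose roots are real. In homogeneous coordinates
  \<open>(X, Y)\<close>, the derivative of such a binary form of degree \<open>n\<close> in the direction \<open>(\<alpha>, \<beta>)\<close> has degree
  \<open>n - 1\<close>, and up to the factor \<open>n\<close> it belongs to the sequence \<open>\<alpha> * a (j + 1) + \<beta> * a j\<close>
  (\<open>polar_deriv_binom_poly\<close>). Dehomogenized, it is the polar derivative
  \<open>\<alpha> P' + \<beta> (n P - X P')\<close>.

  The key fact, \<open>real_rooted_polar_deriv\<close>, is that polar derivatives with real \<open>\<alpha>, \<beta>\<close> preserve
  real-rootedness. It is an argument in the style of Gauss and Lucas: the quotient \<open>Q / P\<close> of the polar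
  derivative and \<open>P\<close>, multiplied by \<open>\<alpha> - \<beta> z\<close>, has at nonreal \<open>z\<close> the imaginary part \<open>- Im z\<close> times a
  sum of nonnegative terms, one for each root and one for the drop of the degree below \<open>n\<close>. If that
  sum vanishes, then all its terms do, and \<open>Q\<close> is identically zero.

  Two applications finish the proof. Writing \<open>f\<close> as a product of \<open>X - r\<^sub>i\<close> and taking the directions
  \<open>(1, - r\<^sub>i)\<close> one after the other turns the sequence of means into \<open>j \<mapsto> S_comb s \<alpha> (s + j) x\<close>, with a
  real-rooted polynomial of formal degree \<open>n - s\<close> (\<open>real_rooted_shift_comb\<close>). Taking the directions
  \<open>(1, 0)\<close> and \<open>(0, 1)\<close> cuts out any three consecutive terms \<open>A, B, C\<close>, so \<open>A + 2 B X + C X\<^sup>2\<close> has no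
  nonreal root unless it is zero, and \<open>A C \<le> B\<^sup>2\<close> (\<open>real_rooted_binom_poly_newton\<close>).
\<close>

section \<open>Real-rooted polynomials and polar derivatives\<close>

text \<open>
  The zero polynomial is included since a derivative of a real-rooted polynomial may vanish
  identically. Complex coefficients are harmless: up to the leading coefficient, the roots
  make the polynomial real.
\<close>
definition real_rooted :: "complex poly \<Rightarrow> bool"
  where "real_rooted p \<longleftrightarrow> p = 0 \<or> (\<forall>z. poly p z = 0 \<longrightarrow> z \<in> \<real>)"

lemma real_rooted_smult: "real_rooted p \<Longrightarrow> real_rooted (smult c p)"
  by (auto simp: real_rooted_def)

lemma real_rooted_factorization:
  assumes "real_rooted p" "p \<noteq> 0"
  obtains B :: "real multiset"
    where "p = smult (lead_coeff p) (\<Prod>r\<in>#B. [:- of_real r, 1:])" "size B = degree p"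
proof -
  obtain A where A: "size A = degree p" "p = smult (lead_coeff p) (\<Prod>x\<in>#A. [:-x, 1:])"
    using alg_closed_imp_factorization[OF assms(2)] by blast
  have "x \<in> \<real>" if "x \<in># A" for x
  proof -
    have "poly (\<Prod>x\<in>#A. [:-x, 1:]) x = 0"
      using that by (auto simp: poly_prod_mset prod_mset_zero_iff)
    hence "poly p x = 0"
      by (metis A(2) mult_zero_right poly_smult)
    thus ?thesis using assms by (auto simp: real_rooted_def)
  qed
  hence "image_mset (\<lambda>x. of_real (Re x)) A = image_mset id A"
    by (intro image_mset_cong) auto
  hence eq: "image_mset of_real (image_mset Re A) = A"
    by (simp add: image_mset.compositionality o_def)
  show ?thesis
  proof (rule that[of "image_mset Re A"])
    have "(\<Prod>r\<in>#image_mset Re A. [:- of_real r, 1:]) =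
          (\<Prod>x\<in>#image_mset of_real (image_mset Re A). [:- x, 1:] :: complex poly)"
      by (simp add: image_mset.compositionality o_def)
    thus "p = smult (lead_coeff p) (\<Prod>r\<in>#image_mset Re A. [:- of_real r, 1:])"
      using A(2) by (simp only: eq)
  qed (use A in simp)
qed

lemma poly_pderiv_prod_mset_linear:
  fixes z :: complex and B :: "real multiset"
  assumes "z \<notin> \<real>"
  shows "poly (pderiv (\<Prod>r\<in>#B. [:- of_real r, 1:])) z =
         poly (\<Prod>r\<in>#B. [:- of_real r, 1:]) z * (\<Sum>r\<in>#B. 1 / (z - of_real r))"
proof (induction B)
  case (add r B)
  have nz: "z - of_real r \<noteq> 0" using assms by auto
  have "poly (pderiv (\<Prod>r\<in>#add_mset r B. [:- of_real r, 1:])) z =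
        (z - of_real r) * poly (pderiv (\<Prod>r\<in>#B. [:- of_real r, 1:])) z +
        poly (\<Prod>r\<in>#B. [:- of_real r, 1:]) z"
    by (simp add: pderiv_mult pderiv_pCons del: mult_pCons_left)
  also have "\<dots> = (z - of_real r) * poly (\<Prod>r\<in>#B. [:- of_real r, 1:]) z *
                    (1 / (z - of_real r) + (\<Sum>r\<in>#B. 1 / (z - of_real r)))"
    using nz by (simp add: add distrib_left mult.assoc)
  finally show ?case
    by (simp add: algebra_simps del: mult_pCons_left)
qed auto

text \<open>
  For \<open>F(X, Y) = Y\<^sup>N p(X / Y)\<close> this is \<open>\<alpha> \<partial>F/\<partial>X + \<beta> \<partial>F/\<partial>Y\<close> at \<open>Y = 1\<close>, by Euler's identity. The
  number \<open>N\<close> is a formal degree: it may exceed the degree of \<open>p\<close>.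
\<close>
definition polar_deriv :: "nat \<Rightarrow> real \<Rightarrow> real \<Rightarrow> complex poly \<Rightarrow> complex poly"
  where "polar_deriv N \<alpha> \<beta> p =
    smult (of_real \<alpha>) (pderiv p) + smult (of_real \<beta>) (smult (of_nat N) p - pCons 0 (pderiv p))"

text \<open>
  The product rule for the homogeneous form, as a sum over its linear factors. A factor \<open>X - r Y\<close>
  contributes \<open>(\<alpha> - \<beta> r) / (z - r)\<close>; each of the remaining \<open>N - size B\<close> factors is \<open>Y\<close>, the root at
  infinity, and contributes \<open>\<beta>\<close>.
\<close>
lemma poly_polar_deriv:
  fixes z :: complex and B :: "real multiset"
  assumes p: "p = smult c (\<Prod>r\<in>#B. [:- of_real r, 1:])" and "size B \<le> N" and z: "z \<notin> \<real>"
  shows "poly (polar_deriv N \<alpha> \<beta> p) z =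
    poly p z * (of_real (\<beta> * real (N - size B)) +
                (\<Sum>r\<in>#B. of_real (\<alpha> - \<beta> * r) / (z - of_real r)))"
proof -
  have "(of_real \<alpha> - of_real \<beta> * z) * (\<Sum>r\<in>#B. 1 / (z - of_real r)) + of_nat (size B) * of_real \<beta> =
        (\<Sum>r\<in>#B. of_real (\<alpha> - \<beta> * r) / (z - of_real r))"
  proof (induction B)
    case (add r B)
    have "z - of_real r \<noteq> 0" using z by auto
    hence "of_real (\<alpha> - \<beta> * r) / (z - of_real r) =
          (of_real \<alpha> - of_real \<beta> * z) * (1 / (z - of_real r)) + of_real \<beta>"
      by (simp add: field_simps)
    with add show ?case by (simp add: algebra_simps)
  qed simp
  moreover have "poly (pderiv p) z = poly p z * (\<Sum>r\<in>#B. 1 / (z - of_real r))"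
    by (simp add: p pderiv_smult poly_pderiv_prod_mset_linear[OF z])
  moreover have "of_real (\<beta> * real (N - size B)) =
                 of_nat N * of_real \<beta> - of_nat (size B) * (of_real \<beta> :: complex)"
    using assms(2) by (simp add: of_nat_diff algebra_simps)
  moreover have "poly (polar_deriv N \<alpha> \<beta> p) z =
      (of_real \<alpha> - of_real \<beta> * z) * poly (pderiv p) z + of_nat N * of_real \<beta> * poly p z"
    by (simp add: polar_deriv_def algebra_simps)
  ultimately show ?thesis
    by (simp only: flip: \<open>_ = (\<Sum>r\<in>#B. of_real (\<alpha> - \<beta> * r) / (z - of_real r))\<close>)
       (simp add: algebra_simps)
qed

text \<open>
  The factor \<open>\<alpha> - \<beta> z\<close> makes the contributions of all roots point into the same half-plane: with
  \<open>y = \<alpha> - \<beta> r\<close> it equals \<open>y - \<beta> (z - r)\<close>, so the product is \<open>y\<^sup>2 / (z - r)\<close> up to a real summand.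
\<close>
lemma Im_polar_kernel:
  assumes "z \<notin> \<real>"
  shows "Im ((of_real \<alpha> - of_real \<beta> * z) * (of_real (\<alpha> - \<beta> * r) / (z - of_real r))) =
         - Im z * ((\<alpha> - \<beta> * r)\<^sup>2 / (cmod (z - of_real r))\<^sup>2)"
proof -
  have "z - of_real r \<noteq> 0" using assms by auto
  hence "(of_real \<alpha> - of_real \<beta> * z) * (of_real (\<alpha> - \<beta> * r) / (z - of_real r)) =
         of_real ((\<alpha> - \<beta> * r)\<^sup>2) / (z - of_real r) - of_real (\<beta> * (\<alpha> - \<beta> * r))"
    by (simp add: field_simps power2_eq_square)
  thus ?thesis
    by (simp only:) (simp add: Im_divide cmod_power2)
qed

lemma Im_polar_sum:
  assumes "z \<notin> \<real>"
  shows "Im ((of_real \<alpha> - of_real \<beta> * z) *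
           (of_real (\<beta> * d) + (\<Sum>r\<in>#B. of_real (\<alpha> - \<beta> * r) / (z - of_real r)))) =
         - Im z * (\<beta>\<^sup>2 * d + (\<Sum>r\<in>#B. (\<alpha> - \<beta> * r)\<^sup>2 / (cmod (z - of_real r))\<^sup>2))"
proof (induction B)
  case empty
  show ?case by (simp add: power2_eq_square)
next
  case (add r B)
  have "Im ((of_real \<alpha> - of_real \<beta> * z) * (of_real (\<beta> * d) +
            (\<Sum>r\<in>#add_mset r B. of_real (\<alpha> - \<beta> * r) / (z - of_real r)))) =
        Im ((of_real \<alpha> - of_real \<beta> * z) * (of_real (\<alpha> - \<beta> * r) / (z - of_real r))) +
        Im ((of_real \<alpha> - of_real \<beta> * z) * (of_real (\<beta> * d) +
            (\<Sum>r\<in>#B. of_real (\<alpha> - \<beta> * r) / (z - of_real r))))"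
    unfolding plus_complex.sel[symmetric] distrib_left[symmetric]
    by (simp only: image_mset_add_mset sum_mset.add_mset add.left_commute)
  thus ?case
    unfolding add Im_polar_kernel[OF assms] by (simp add: algebra_simps)
qed

lemma real_rooted_polar_deriv:
  assumes "real_rooted p" and deg: "degree p \<le> N"
  shows "real_rooted (polar_deriv N \<alpha> \<beta> p)"
proof (cases "p = 0")
  case True
  thus ?thesis by (simp add: polar_deriv_def real_rooted_def)
next
  case False
  obtain B :: "real multiset"
    where B: "p = smult (lead_coeff p) (\<Prod>r\<in>#B. [:- of_real r, 1:])" "size B = degree p"
    using real_rooted_factorization[OF assms(1) False] .
  define Q where "Q = polar_deriv N \<alpha> \<beta> p"
  define G where "G z = of_real (\<beta> * real (N - size B)) +
                  (\<Sum>r\<in>#B. of_real (\<alpha> - \<beta> * r) / (z - of_real r))" for z :: complex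
  have Q: "poly Q z = poly p z * G z" if "z \<notin> \<real>" for z
    unfolding Q_def G_def by (rule poly_polar_deriv[OF B(1) _ that]) (use B deg in simp)
  show ?thesis
  proof (cases "\<exists>z. z \<notin> \<real> \<and> poly Q z = 0")
    case True
    then obtain z where z: "z \<notin> \<real>" "poly Q z = 0" by blast
    have "poly p z \<noteq> 0" using z(1) assms(1) False by (auto simp: real_rooted_def)
    hence "G z = 0" using Q z by auto
    \<comment> \<open>One nonreal zero makes the sum of nonnegative terms vanish, so that \<open>G\<close> is zero everywhere.\<close>
    hence "Im ((of_real \<alpha> - of_real \<beta> * z) * G z) = 0" by simp
    moreover have "Im z \<noteq> 0" using z(1) complex_is_Real_iff by blast
    ultimately have sum0: "\<beta>\<^sup>2 * real (N - size B) +
        (\<Sum>r\<in>#B. (\<alpha> - \<beta> * r)\<^sup>2 / (cmod (z - of_real r))\<^sup>2) = 0"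
      unfolding G_def Im_polar_sum[OF z(1)] by simp
    have nonneg: "\<beta>\<^sup>2 * real (N - size B) \<ge> 0" by simp
    have nonneg2: "0 \<le> (\<Sum>r\<in>#C. (\<alpha> - \<beta> * r)\<^sup>2 / (cmod (z - of_real r))\<^sup>2)" for C
      by (induction C) auto
    have d0: "\<beta> * real (N - size B) = 0"
      using sum0 nonneg nonneg2[of B] by (auto simp: add_nonneg_eq_0_iff)
    have r0: "\<alpha> - \<beta> * r = 0" if mem: "r \<in># B" for r
    proof -
      obtain C where C: "B = add_mset r C" using multi_member_split[OF mem] by blast
      have "z - of_real r \<noteq> 0" using z(1) by auto
      moreover have "(\<Sum>r\<in>#B. (\<alpha> - \<beta> * r)\<^sup>2 / (cmod (z - of_real r))\<^sup>2) = 0"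
        using sum0 nonneg nonneg2[of B] by linarith
      hence "(\<alpha> - \<beta> * r)\<^sup>2 / (cmod (z - of_real r))\<^sup>2 = 0"
        using nonneg2[of C] by (auto simp: C add_nonneg_eq_0_iff)
      ultimately show ?thesis by simp
    qed
    have "G w = 0" for w
    proof -
      have "(\<Sum>r\<in>#B. of_real (\<alpha> - \<beta> * r) / (w - of_real r)) = (\<Sum>r\<in>#B. 0)"
        by (intro arg_cong[where f = sum_mset] image_mset_cong) (simp only: r0, simp)
      thus ?thesis by (simp add: G_def d0 del: of_real_mult of_real_diff)
    qed
    hence zero: "poly Q w = 0" if "w \<notin> \<real>" for w
      using Q that by simp
    \<comment> \<open>Any infinite set of nonreal points, such as this line, forces \<open>Q = 0\<close>.\<close>
    have "(\<lambda>t. of_real t + \<i>) ` (UNIV :: real set) \<subseteq> {w. poly Q w = 0}"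
      by (auto intro!: zero simp: complex_is_Real_iff)
    moreover have "infinite ((\<lambda>t. of_real t + \<i>) ` (UNIV :: real set))"
      by (subst finite_image_iff) (auto simp: inj_on_def infinite_UNIV_char_0)
    ultimately have "Q = 0"
      using poly_roots_finite finite_subset by blast
    thus ?thesis by (simp add: real_rooted_def Q_def)
  qed (auto simp: real_rooted_def Q_def)
qed

section \<open>Sequences with binomial weights\<close>

definition binom_poly :: "nat \<Rightarrow> (nat \<Rightarrow> complex) \<Rightarrow> complex poly"
  where "binom_poly n a = (\<Sum>j\<le>n. monom (of_nat (n choose j) * a j) j)"

lemma coeff_binom_poly: "coeff (binom_poly n a) j = of_nat (n choose j) * a j"
  by (simp add: binom_poly_def coeff_sum not_le sum.delta' cong: if_cong)

lemma degree_binom_poly: "degree (binom_poly n a) \<le> n"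
  by (intro degree_le) (simp add: coeff_binom_poly)

text \<open>
  The binomial weights are what makes directional derivatives act on sequences without any
  factor depending on the index: the two absorption identities
  \<open>(j + 1) * (n + 1 choose j + 1) = (n + 1) * (n choose j)\<close> and
  \<open>(n + 1 - j) * (n + 1 choose j) = (n + 1) * (n choose j)\<close> have the same right-hand side.
\<close>
lemma polar_deriv_binom_poly:
  "polar_deriv (Suc n) \<alpha> \<beta> (binom_poly (Suc n) a) =
   smult (of_nat (Suc n)) (binom_poly n (\<lambda>j. of_real \<alpha> * a (Suc j) + of_real \<beta> * a j))"
proof (rule poly_eqI)
  fix j
  have 1: "of_nat (Suc j) * of_nat (Suc n choose Suc j) = (of_nat (Suc n) * of_nat (n choose j) :: complex)"
    by (metis Suc_times_binomial_eq mult.commute of_nat_mult)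
  have 2: "of_nat (Suc n) * of_nat (n choose j) + of_nat j * of_nat (Suc n choose j) =
           (of_nat (Suc n) * of_nat (Suc n choose j) :: complex)"
  proof (cases j)
    case (Suc i)
    have "of_nat (Suc i) * of_nat (Suc n choose Suc i) = (of_nat (Suc n) * of_nat (n choose i) :: complex)"
      by (metis Suc_times_binomial_eq mult.commute of_nat_mult)
    thus ?thesis unfolding Suc
      by (simp add: algebra_simps del: of_nat_Suc)
  qed simp
  have X: "coeff (pCons 0 (pderiv (binom_poly (Suc n) a))) j = of_nat j * coeff (binom_poly (Suc n) a) j"
    by (cases j) (simp_all add: coeff_pderiv)
  have "coeff (polar_deriv (Suc n) \<alpha> \<beta> (binom_poly (Suc n) a)) j =
    of_real \<alpha> * (of_nat (Suc j) * of_nat (Suc n choose Suc j)) * a (Suc j) +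
    of_real \<beta> * (of_nat (Suc n) * of_nat (Suc n choose j) - of_nat j * of_nat (Suc n choose j)) * a j"
    unfolding polar_deriv_def coeff_add coeff_smult coeff_diff X
    by (simp add: coeff_pderiv coeff_binom_poly algebra_simps del: of_nat_Suc binomial_Suc_Suc)
  also have "\<dots> = of_real \<alpha> * (of_nat (Suc n) * of_nat (n choose j)) * a (Suc j) +
                  of_real \<beta> * (of_nat (Suc n) * of_nat (n choose j)) * a j"
    unfolding 1 2[symmetric] by simp
  finally show "coeff (polar_deriv (Suc n) \<alpha> \<beta> (binom_poly (Suc n) a)) j =
    coeff (smult (of_nat (Suc n)) (binom_poly n (\<lambda>j. of_real \<alpha> * a (Suc j) + of_real \<beta> * a j))) j"
    by (simp add: coeff_binom_poly algebra_simps del: of_nat_Suc)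
qed

lemma real_rooted_binom_poly_step:
  assumes "real_rooted (binom_poly (Suc n) a)"
  shows "real_rooted (binom_poly n (\<lambda>j. of_real \<alpha> * a (Suc j) + of_real \<beta> * a j))"
proof -
  have "real_rooted (smult (inverse (of_nat (Suc n))) (polar_deriv (Suc n) \<alpha> \<beta> (binom_poly (Suc n) a)))"
    by (intro real_rooted_smult real_rooted_polar_deriv assms degree_binom_poly)
  thus ?thesis by (simp add: polar_deriv_binom_poly del: of_nat_Suc)
qed

text \<open>
  The direction \<open>(0, 1)\<close> drops the last term of the sequence, and \<open>(1, 0)\<close> drops the first.
\<close>
lemma real_rooted_binom_poly_window:
  assumes "real_rooted (binom_poly n a)" "i + m \<le> n"
  shows "real_rooted (binom_poly m (\<lambda>j. a (i + j)))"
proof -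
  have "real_rooted (binom_poly (i + m) a)"
    using assms(2,1)
  proof (induction rule: dec_induct)
    case (step n)
    thus ?case using real_rooted_binom_poly_step[of n a 0 1] by simp
  qed
  thus ?thesis
  proof (induction i arbitrary: a)
    case (Suc i)
    have "real_rooted (binom_poly (i + m) (\<lambda>j. a (Suc j)))"
      using real_rooted_binom_poly_step[of "i + m" a 1 0] Suc.prems by simp
    from Suc.IH[OF this] show ?case by simp
  qed simp
qed

text \<open>
  Otherwise the quadratic polynomial cut out by the window would have a negative discriminant.
\<close>
lemma real_rooted_binom_poly_newton:
  fixes a :: "nat \<Rightarrow> real"
  assumes "real_rooted (binom_poly n (\<lambda>j. of_real (a j)))" "i + 2 \<le> n"
  shows "a i * a (i + 2) \<le> (a (i + 1))\<^sup>2"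
proof (rule ccontr)
  assume contra: "\<not> ?thesis"
  define A B C where "A = a i" and "B = a (i + 1)" and "C = a (i + 2)"
  define p where "p = binom_poly 2 (\<lambda>j. of_real (a (i + j)))"
  have less: "B\<^sup>2 < A * C" using contra by (simp add: A_def B_def C_def)
  hence "A * C > 0" by (smt (verit) zero_le_power2)
  hence "C \<noteq> 0" by auto
  have "coeff p 2 = of_real C"
    by (simp add: p_def coeff_binom_poly C_def)
  hence "p \<noteq> 0" using \<open>C \<noteq> 0\<close> by auto
  have "real_rooted p"
    unfolding p_def
    using real_rooted_binom_poly_window[OF assms] by simp
  have p: "poly p z = of_real A + 2 * of_real B * z + of_real C * z\<^sup>2" for z
    by (simp add: p_def binom_poly_def poly_sum poly_monom numeral_2_eq_2 A_def B_def C_def)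
  define D where "D = sqrt (A * C - B\<^sup>2)"
  have D: "D\<^sup>2 = A * C - B\<^sup>2" "D > 0" using less by (simp_all add: D_def)
  \<comment> \<open>The root of \<open>A + 2 B X + C X\<^sup>2\<close> given by the quadratic formula; its imaginary part is \<open>D / C\<close>.\<close>
  define z where "z = Complex (- B) D / of_real C"
  have Cz: "of_real C * z = Complex (- B) D" using \<open>C \<noteq> 0\<close> by (simp add: z_def)
  have "of_real C * poly p z = of_real (A * C) + 2 * of_real B * (of_real C * z) + (of_real C * z)\<^sup>2"
    by (simp add: p power2_eq_square algebra_simps)
  also have "\<dots> = 0"
    unfolding Cz using D(1) by (simp add: complex_eq_iff power2_eq_square algebra_simps)
  finally have "poly p z = 0" using \<open>C \<noteq> 0\<close> by simp
  hence "z \<in> \<real>" using \<open>real_rooted p\<close> \<open>p \<noteq> 0\<close> by (auto simp: real_rooted_def)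
  hence "Im z = 0" by (simp add: complex_is_Real_iff)
  thus False using D(2) \<open>C \<noteq> 0\<close> by (simp add: z_def)
qed

section \<open>Shift operators\<close>

text \<open>
  The polynomial \<open>f\<close> acts on sequences with \<open>X\<close> acting as the shift \<open>a \<mapsto> (\<lambda>j. a (j + 1))\<close>.
\<close>
definition shift_comb :: "complex poly \<Rightarrow> (nat \<Rightarrow> complex) \<Rightarrow> nat \<Rightarrow> complex"
  where "shift_comb f a j = (\<Sum>i\<le>degree f. coeff f i * a (i + j))"

lemma shift_comb_eq_sum:
  assumes "degree f \<le> N"
  shows "shift_comb f a j = (\<Sum>i\<le>N. coeff f i * a (i + j))"
  unfolding shift_comb_def using assms
  by (intro sum.mono_neutral_left) (auto simp: coeff_eq_0)

lemma shift_comb_linear_mult: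
  "shift_comb ([:- r, 1:] * f) a j = shift_comb f a (Suc j) - r * shift_comb f a j"
proof -
  define N where "N = degree f"
  have "degree ([:- r, 1:] * f) \<le> Suc N"
    unfolding N_def using degree_mult_le[of "[:- r, 1:]" f] by simp
  hence "shift_comb ([:- r, 1:] * f) a j = (\<Sum>i\<le>Suc N. coeff ([:- r, 1:] * f) i * a (i + j))"
    by (rule shift_comb_eq_sum)
  also have "\<dots> = (\<Sum>i\<le>Suc N. coeff (pCons 0 f) i * a (i + j)) - r * (\<Sum>i\<le>Suc N. coeff f i * a (i + j))"
    by (simp add: sum_subtractf sum_distrib_left algebra_simps sum.distrib del: sum.atMost_Suc)
  also have "(\<Sum>i\<le>Suc N. coeff (pCons 0 f) i * a (i + j)) = (\<Sum>i\<le>N. coeff f i * a (i + Suc j))"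
    by (subst sum.atMost_Suc_shift) simp
  also have "\<dots> = shift_comb f a (Suc j)"
    by (simp add: shift_comb_def N_def)
  also have "(\<Sum>i\<le>Suc N. coeff f i * a (i + j)) = shift_comb f a j"
    by (subst shift_comb_eq_sum[of f "Suc N"]) (simp_all add: N_def)
  finally show ?thesis .
qed

text \<open>
  Each root \<open>r\<close> of \<open>f\<close> is one derivative in the direction \<open>(1, - r)\<close>, which costs one degree and
  needs \<open>r\<close> to be real.
\<close>
lemma real_rooted_shift_comb:
  assumes "\<And>z. poly f z = 0 \<Longrightarrow> z \<in> \<real>"
    and "real_rooted (binom_poly (m + degree f) a)"
  shows "real_rooted (binom_poly m (shift_comb f a))"
  using assms
proof (induction "degree f" arbitrary: f m)
  case 0
  then obtain c where c: "f = [:c:]" using degree_eq_zeroE by metis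
  have "binom_poly m (shift_comb f a) = smult c (binom_poly m a)"
    by (rule poly_eqI) (simp add: coeff_binom_poly shift_comb_def c)
  thus ?case using 0 by (simp add: real_rooted_smult)
next
  case (Suc d)
  obtain z where z: "poly f z = 0"
    using alg_closed_imp_poly_has_root[of f] Suc.hyps(2) by auto
  then obtain r where r: "z = of_real r" using Suc.prems(1) Reals_cases by metis
  obtain g where g: "f = [:- of_real r, 1:] * g"
    using z r poly_eq_0_iff_dvd dvdE by metis
  have "g \<noteq> 0" using g Suc.hyps(2) by auto
  hence deg: "degree f = Suc (degree g)" unfolding g by (subst degree_mult_eq) auto
  have "real_rooted (binom_poly (Suc m) (shift_comb g a))"
  proof (rule Suc.hyps(1))
    show "d = degree g" using deg Suc.hyps(2) by simp
    show "z \<in> \<real>" if "poly g z = 0" for z using Suc.prems(1)[of z] that by (simp add: g)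
    show "real_rooted (binom_poly (Suc m + degree g) a)" using Suc.prems(2) deg by simp
  qed
  from real_rooted_binom_poly_step[OF this, of 1 "- r"] show ?case
    unfolding g by (simp add: shift_comb_linear_mult [abs_def] del: mult_pCons_left)
qed

section \<open>Elementary symmetric means\<close>

lemma coeff_prod_esym:
  fixes x :: "real ^ 'n"
  shows "coeff (\<Prod>i\<in>UNIV. [:1, of_real (x $ i):] :: complex poly) j = of_real (esym (int j) x)"
proof -
  have monom: "(\<Prod>i\<in>I. [:0, of_real (x $ i):] :: complex poly) =
        monom (of_real (\<Prod>i\<in>I. x $ i)) (card I)" for I :: "'n set"
    by (induction I rule: infinite_finite_induct) (auto simp: monom_Suc smult_monom)
  have "(\<Prod>i\<in>UNIV. [:1, of_real (x $ i):] :: complex poly) =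
        (\<Prod>i\<in>UNIV. [:0, of_real (x $ i):] + 1)"
    by (simp add: one_pCons)
  also have "\<dots> = (\<Sum>I\<in>UNIV. monom (of_real (\<Prod>i\<in>I. x $ i)) (card I))"
    by (subst prod_add) (simp_all add: monom)
  finally show ?thesis
    by (simp add: coeff_sum esym_def sum.If_cases)
qed

lemma real_rooted_esym_mean:
  fixes x :: "real ^ 'n"
  shows "real_rooted (binom_poly CARD('n) (\<lambda>j. of_real (esym_mean (int j) x)))"
proof -
  have "binom_poly CARD('n) (\<lambda>j. of_real (esym_mean (int j) x)) =
        (\<Prod>i\<in>UNIV. [:1, of_real (x $ i):])"
  proof (rule poly_eqI)
    fix j
    have "esym (int j) x = 0" if "CARD('n) choose j = 0"
    proof -
      have "CARD('n) < j" using that by (simp add: binomial_eq_0_iff)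
      moreover have "card I \<le> CARD('n)" for I :: "'n set" by (simp add: card_mono)
      ultimately have "{I :: 'n set. I \<subseteq> UNIV \<and> int (card I) = int j} = {}"
        using leD by auto
      thus ?thesis unfolding esym_def by simp
    qed
    thus "coeff (binom_poly CARD('n) (\<lambda>j. of_real (esym_mean (int j) x))) j =
          coeff (\<Prod>i\<in>UNIV. [:1, of_real (x $ i):]) j"
      by (auto simp: coeff_prod_esym coeff_binom_poly esym_mean_def)
  qed
  moreover have "z \<in> \<real>" if "1 + of_real (t :: real) * z = 0" for t and z :: complex
  proof -
    have "t \<noteq> 0" using that by auto
    hence "z = of_real (- 1 / t)" using that by (simp add: field_simps add_eq_0_iff)
    thus ?thesis by (metis Reals_of_real)
  qed
  ultimately show ?thesis
    by (auto simp: real_rooted_def poly_prod mult.commute)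
qed

lemma coeff_assoc_poly:
  "coeff (assoc_poly s \<alpha>) i = (if i < s then \<alpha> (s - i) else if i = s then 1 else 0)"
proof -
  have "(\<Sum>j=1..s. if s - j = i then \<alpha> j else 0) = (if i < s then \<alpha> (s - i) else 0)"
  proof -
    have "(\<Sum>j=1..s. if s - j = i then \<alpha> j else 0) = (\<Sum>j=1..s. if j = s - i \<and> i < s then \<alpha> j else 0)"
      by (intro sum.cong) auto
    thus ?thesis by (cases "i < s") (simp_all add: sum.delta')
  qed
  thus ?thesis by (auto simp: assoc_poly_def coeff_sum)
qed

lemma degree_assoc_poly: "degree (assoc_poly s \<alpha>) = s"
  by (intro antisym degree_le le_degree) (auto simp: coeff_assoc_poly)

text \<open>
  The index is offset by \<open>s\<close>: the leading term of \<open>f\<close> shifts by \<open>s\<close> and carries the mean of index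
  \<open>s + j\<close>, while the constant term carries that of index \<open>j\<close>.
\<close>
lemma S_comb_eq_shift_comb:
  "of_real (S_comb s \<alpha> (int (s + j)) x) =
   shift_comb (map_poly complex_of_real (assoc_poly s \<alpha>)) (\<lambda>j. of_real (esym_mean (int j) x)) j"
proof -
  have "(\<Sum>i<s. \<alpha> (s - i) * esym_mean (int (i + j)) x) =
        (\<Sum>i=1..s. \<alpha> i * esym_mean (int (s + j) - int i) x)"
    by (rule sum.reindex_bij_witness[of _ "\<lambda>i. s - i" "\<lambda>i. s - i"]) (auto simp: of_nat_diff algebra_simps)
  hence "S_comb s \<alpha> (int (s + j)) x = (\<Sum>i\<le>s. coeff (assoc_poly s \<alpha>) i * esym_mean (int (i + j)) x)"
    by (simp add: S_comb_def coeff_assoc_poly flip: lessThan_Suc_atMost)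
  thus ?thesis
    by (simp add: shift_comb_def coeff_map_poly degree_map_poly degree_assoc_poly)
qed

theorem corollary4:
  fixes s :: nat and \<alpha> :: "nat \<Rightarrow> real" and k :: int
  assumes "1 \<le> s" and "int s < int CARD('n::finite) - 1"
    and "k \<in> {int s + 1..int CARD('n) - 1}"
    and "\<exists>x0 :: real ^ 'n.
           (S_comb s \<alpha> k x0)\<^sup>2 < S_comb s \<alpha> (k - 1) x0 * S_comb s \<alpha> (k + 1) x0"
  shows "\<exists>z :: complex. z \<notin> \<real> \<and> poly (map_poly complex_of_real (assoc_poly s \<alpha>)) z = 0"
proof (rule ccontr)
  define f where "f = map_poly complex_of_real (assoc_poly s \<alpha>)"
  assume "\<not> ?thesis"
  hence roots: "z \<in> \<real>" if "poly f z = 0" for z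
    using that by (auto simp: f_def)
  obtain x :: "real ^ 'n" where
    x: "(S_comb s \<alpha> k x)\<^sup>2 < S_comb s \<alpha> (k - 1) x * S_comb s \<alpha> (k + 1) x"
    using assms(4) by blast
  define i where "i = nat (k - 1 - int s)"
  define S where "S j = S_comb s \<alpha> (int (s + j)) x" for j
  have i: "int (s + i) = k - 1" using assms(3) by (simp add: i_def)
  have "degree f = s"
    by (simp add: f_def degree_map_poly degree_assoc_poly)
  hence "real_rooted (binom_poly (CARD('n) - s + degree f) (\<lambda>j. of_real (esym_mean (int j) x)))"
    using assms(2) by (simp add: real_rooted_esym_mean)
  from real_rooted_shift_comb[OF roots this]
  have "real_rooted (binom_poly (CARD('n) - s) (\<lambda>j. of_real (S j)))"
    by (simp only: S_def S_comb_eq_shift_comb f_def)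
  moreover have "i + 2 \<le> CARD('n) - s" using i assms(3) by auto
  ultimately have "S i * S (i + 2) \<le> (S (i + 1))\<^sup>2"
    by (rule real_rooted_binom_poly_newton)
  moreover have "int (s + (i + 1)) = k" "int (s + (i + 2)) = k + 1" using i by auto
  hence "S (i + 1) = S_comb s \<alpha> k x" "S (i + 2) = S_comb s \<alpha> (k + 1) x"
    unfolding S_def by (simp_all only:)
  moreover have "S i = S_comb s \<alpha> (k - 1) x" unfolding S_def i ..
  ultimately show False using x by simp
qed

end
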